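(* Let $\mathbf{k}$ be a field. (a) Let $(A,\cdot,\circ)$ be a Jacobi Novikov-Poisson algebra over $\mathbf{k}$. Then $(A,\cdot,[\cdot,\cdot])$ is a Jacobi algebra, where $[a,b]:=a\circ b-b\circ a$ for all $a,b\in A$. (b) Let $(A,\cdot,\circ)$ be a Jacobi Novikov-Poisson algebra over $\mathbf{k}$ with a derivation $P$, i.e. $P:A\to A$ is a linear map that is a derivation of both $(A,\cdot)$ and $(A,\circ)$. Then $(A,\cdot,[\cdot,\cdot])$ is a Jacobi algebra, where $[a,b]:=P(a)\circ b-P(b)\circ a$ for all $a,b\in A$.
   Context: All vector spaces and algebras are over $\mathbf{k}$; binary operations are bilinear. A Novikov algebra $(A,\circ)$ is a vector space with a binary operation satisfying $(a\circ b)\circ c-a\circ(b\circ c)=(b\circ a)\circ c-b\circ(a\circ c)$ and $(a\circ b)\circ c=(a\circ c)\circ b$ for all $a,b,c\in A$. A Jacobi Novikov-Poisson algebra is a triple $(A,\cdot,\circ)$ where $(A,\cdot)$ is a unital commutative associative algebra with identity $1_A$, $(A,\circ)$ is a Novikov algebra, and for all $a,b,c\in A$: $(a\cdot b)\circ c=a\cdot(b\circ c)$ and $c\circ(a\cdot b)=(c\circ a)\cdot b+a\cdot(c\circ b)-a\cdot b\cdot(c\circ 1_A)$. A Jacobi algebra is a triple $(A,\cdot,[\cdot,\cdot])$ where $(A,\cdot)$ is a unital commutative associative algebra with identity $1_A$, $(A,[\cdot,\cdot])$ is a Lie algebra, and $[a,b\cdot c]=[a,b]\cdot c+b\cdot[a,c]+b\cdot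 c\cdot[1_A,a]$ for all $a,b,c\in A$. *)

theory Defs
  imports Complex_Main
begin

text \<open>
  The underlying vector space is a whole type with a scalar multiplication \<open>scale\<close>. Binary
  operations and the identity \<open>one\<close> are explicit parameters, so that several operations can live
  on one space; \<open>one = 0\<close> (the zero algebra) is allowed, and the field may have any characteristic.
\<close>

locale bilinear_operation = vector_space scale
  for scale :: "'k::field \<Rightarrow> 'a::ab_group_add \<Rightarrow> 'a"
  and opn :: "'a \<Rightarrow> 'a \<Rightarrow> 'a" +
  assumes linear_left: "Vector_Spaces.linear scale scale (\<lambda>a. opn a b)"
    and linear_right: "Vector_Spaces.linear scale scale (\<lambda>b. opn a b)"

locale unital_comm_assoc_algebra = bilinear_operation scale mult + comm_monoid mult one
  for scale :: "'k::field \<Rightarrow> 'a::ab_group_add \<Rightarrow> 'a"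
  and mult :: "'a \<Rightarrow> 'a \<Rightarrow> 'a"  (infixl \<open>\<cdot>\<close> 70)
  and one :: 'a

locale novikov_algebra = bilinear_operation scale nov
  for scale :: "'k::field \<Rightarrow> 'a::ab_group_add \<Rightarrow> 'a"
  and nov :: "'a \<Rightarrow> 'a \<Rightarrow> 'a"  (infixl \<open>\<odot>\<close> 70) +
  assumes left_symmetric: "(a \<odot> b) \<odot> c - a \<odot> (b \<odot> c) = (b \<odot> a) \<odot> c - b \<odot> (a \<odot> c)"
    and right_commutative: "(a \<odot> b) \<odot> c = (a \<odot> c) \<odot> b"

text \<open>
  The alternating law is used rather than antisymmetry, which is weaker in characteristic 2.
\<close>

locale lie_algebra = bilinear_operation scale br
  for scale :: "'k::field \<Rightarrow> 'a::ab_group_add \<Rightarrow> 'a"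
  and br :: "'a \<Rightarrow> 'a \<Rightarrow> 'a" +
  assumes alternating: "br a a = 0"
    and jacobi_identity: "br a (br b c) + br b (br c a) + br c (br a b) = 0"

locale jacobi_novikov_poisson_algebra =
  unital_comm_assoc_algebra scale mult one + novikov_algebra scale nov
  for scale :: "'k::field \<Rightarrow> 'a::ab_group_add \<Rightarrow> 'a"
  and mult :: "'a \<Rightarrow> 'a \<Rightarrow> 'a"  (infixl \<open>\<cdot>\<close> 70)
  and one :: 'a
  and nov :: "'a \<Rightarrow> 'a \<Rightarrow> 'a"  (infixl \<open>\<odot>\<close> 70) +
  assumes mult_nov: "(a \<cdot> b) \<odot> c = a \<cdot> (b \<odot> c)"
    and nov_mult: "c \<odot> (a \<cdot> b) = (c \<odot> a) \<cdot> b + a \<cdot> (c \<odot> b) - a \<cdot> b \<cdot> (c \<odot> one)"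

locale jacobi_algebra =
  unital_comm_assoc_algebra scale mult one + lie_algebra scale br
  for scale :: "'k::field \<Rightarrow> 'a::ab_group_add \<Rightarrow> 'a"
  and mult :: "'a \<Rightarrow> 'a \<Rightarrow> 'a"  (infixl \<open>\<cdot>\<close> 70)
  and one :: 'a
  and br :: "'a \<Rightarrow> 'a \<Rightarrow> 'a" +
  assumes br_mult: "br a (b \<cdot> c) = br a b \<cdot> c + b \<cdot> br a c + b \<cdot> c \<cdot> br one a"

definition derivation ::
  "('k::field \<Rightarrow> 'a::ab_group_add \<Rightarrow> 'a) \<Rightarrow> ('a \<Rightarrow> 'a \<Rightarrow> 'a) \<Rightarrow> ('a \<Rightarrow> 'a) \<Rightarrow> bool"
  where "derivation scale opn P \<longleftrightarrow>
    Vector_Spaces.linear scale scale P \<and>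
    (\<forall>a b. P (opn a b) = opn (P a) b + opn a (P b))"

end

theory Submission
  imports Defs
begin

text \<open>
  Multiplication in the first argument of a Novikov product can be pulled out, so
  \<open>a \<odot> b = a \<cdot> D b\<close> for the single operator \<open>D b = one \<odot> b\<close>. The second compatibility
  law says that \<open>D\<close> is a differential operator of order at most one, that is,
  \<open>D (a \<cdot> b) = D a \<cdot> b + a \<cdot> D b - a \<cdot> b \<cdot> D one\<close>.

  Both brackets of the theorem therefore have the form \<open>[a, b] = P a \<cdot> D b - P b \<cdot> D a\<close>, where
  \<open>P\<close> is the identity in the first case and the given derivation in the second. In both cases
  \<open>P\<close> is itself an operator of order at most one that commutes with \<open>D\<close>: the identity
  trivially, and a derivation because it kills \<open>one\<close>, so that applying it to \<open>one \<odot> b\<close> gives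
  \<open>P (D b) = D (P b)\<close>. The theorem is thus two instances of one statement,
  \<open>wronskian_bracket_jacobi_algebra\<close>: the Wronskian bracket of any two commuting operators of
  order at most one is a Jacobi bracket.
\<close>

context unital_comm_assoc_algebra
begin

lemma mult_add_left: "(a + b) \<cdot> c = a \<cdot> c + b \<cdot> c"
  and mult_diff_left: "(a - b) \<cdot> c = a \<cdot> c - b \<cdot> c"
  and mult_scale_left: "scale r a \<cdot> c = scale r (a \<cdot> c)"
proof -
  interpret M: Vector_Spaces.linear scale scale "\<lambda>a. a \<cdot> c"
    by (rule linear_left)
  show "(a + b) \<cdot> c = a \<cdot> c + b \<cdot> c" "(a - b) \<cdot> c = a \<cdot> c - b \<cdot> c"
    "scale r a \<cdot> c = scale r (a \<cdot> c)"
    by (rule M.add M.diff M.scale)+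
qed

lemma mult_add_right: "c \<cdot> (a + b) = c \<cdot> a + c \<cdot> b"
  and mult_diff_right: "c \<cdot> (a - b) = c \<cdot> a - c \<cdot> b"
  and mult_scale_right: "c \<cdot> scale r a = scale r (c \<cdot> a)"
  by (simp_all add: commute[of c] mult_add_left mult_diff_left mult_scale_left)

text \<open>
  These are the sums of a derivation and the multiplication by \<open>D one\<close>. The derivations are
  those with \<open>D one = 0\<close>; the correction term also admits all multiplication operators, in
  particular the identity.
\<close>

definition first_order_operator :: "('a \<Rightarrow> 'a) \<Rightarrow> bool"
  where "first_order_operator D \<longleftrightarrow>
    Vector_Spaces.linear scale scale D \<and>
    (\<forall>a b. D (a \<cdot> b) = D a \<cdot> b + a \<cdot> D b - a \<cdot> b \<cdot> D one)"

lemma first_order_operator_id: "first_order_operator (\<lambda>a. a)"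
  by (simp add: first_order_operator_def linear_ident)

text \<open>The Leibniz rule for \<open>one \<cdot> one\<close> reads \<open>P one = P one + P one\<close>.\<close>

lemma derivation_one:
  assumes "derivation scale mult P"
  shows "P one = 0"
  using assms unfolding derivation_def by (metis add_cancel_left_left left_neutral right_neutral)

lemma derivation_imp_first_order_operator:
  assumes "derivation scale mult P"
  shows "first_order_operator P"
  using assms derivation_one[OF assms] mult_diff_right[of _ 0 0]
  by (simp add: first_order_operator_def derivation_def)

text \<open>
  In the Jacobi identity, the correction terms in \<open>P one\<close> and \<open>D one\<close> are multiples of the
  cyclic sums of \<open>D a \<cdot> (P b \<cdot> D c - P c \<cdot> D b)\<close> and \<open>P a \<cdot> (P b \<cdot> D c - P c \<cdot> D b)\<close>, which
  vanish as determinants with a repeated row. What remains cancels as for the classical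
  bracket of two commuting derivations, because \<open>P (D x) = D (P x)\<close>.
\<close>

lemma wronskian_bracket_jacobi_algebra:
  assumes P: "first_order_operator P" and D: "first_order_operator D"
    and commuting: "\<And>a. P (D a) = D (P a)"
  shows "jacobi_algebra scale mult one (\<lambda>a b. P a \<cdot> D b - P b \<cdot> D a)"
proof -
  interpret P: Vector_Spaces.linear scale scale P
    using P by (simp add: first_order_operator_def)
  interpret D: Vector_Spaces.linear scale scale D
    using D by (simp add: first_order_operator_def)
  have leibniz: "P (a \<cdot> b) = P a \<cdot> b + a \<cdot> P b - a \<cdot> b \<cdot> P one"
    "D (a \<cdot> b) = D a \<cdot> b + a \<cdot> D b - a \<cdot> b \<cdot> D one" for a b
    using P D by (simp_all add: first_order_operator_def)
  note distrib = mult_add_left mult_diff_left mult_scale_left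
    mult_add_right mult_diff_right mult_scale_right
  note ac = assoc commute left_commute
  show ?thesis
  proof (intro jacobi_algebra.intro lie_algebra.intro bilinear_operation.intro
      bilinear_operation_axioms.intro lie_algebra_axioms.intro jacobi_algebra_axioms.intro
      unital_comm_assoc_algebra_axioms vector_space_axioms)
    show "Vector_Spaces.linear scale scale (\<lambda>a. P a \<cdot> D b - P b \<cdot> D a)" for b
      by (simp add: Vector_Spaces.linear_iff vector_space_axioms P.add D.add P.scale D.scale
          distrib scale_right_diff_distrib)
    show "Vector_Spaces.linear scale scale (\<lambda>b. P a \<cdot> D b - P b \<cdot> D a)" for a
      by (simp add: Vector_Spaces.linear_iff vector_space_axioms P.add D.add P.scale D.scale
          distrib scale_right_diff_distrib)
    show "P a \<cdot> D a - P a \<cdot> D a = 0" for a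
      by simp
    show "P a \<cdot> D (P b \<cdot> D c - P c \<cdot> D b) - P (P b \<cdot> D c - P c \<cdot> D b) \<cdot> D a
        + (P b \<cdot> D (P c \<cdot> D a - P a \<cdot> D c) - P (P c \<cdot> D a - P a \<cdot> D c) \<cdot> D b)
        + (P c \<cdot> D (P a \<cdot> D b - P b \<cdot> D a) - P (P a \<cdot> D b - P b \<cdot> D a) \<cdot> D c) = 0" for a b c
      by (simp add: P.diff D.diff leibniz commuting distrib ac)
    show "P a \<cdot> D (b \<cdot> c) - P (b \<cdot> c) \<cdot> D a
        = (P a \<cdot> D b - P b \<cdot> D a) \<cdot> c + b \<cdot> (P a \<cdot> D c - P c \<cdot> D a)
          + b \<cdot> c \<cdot> (P one \<cdot> D a - P a \<cdot> D one)" for a b c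
      by (simp add: leibniz distrib ac)
  qed
qed

end

context jacobi_novikov_poisson_algebra
begin

lemma nov_eq_mult: "a \<odot> b = a \<cdot> (one \<odot> b)"
  by (metis mult_nov right_neutral)

lemma first_order_operator_nov_one: "first_order_operator (\<lambda>b. one \<odot> b)"
  unfolding first_order_operator_def
  using novikov_algebra_axioms nov_mult
  by (auto simp: novikov_algebra_def bilinear_operation_def bilinear_operation_axioms_def)

text \<open>
  Since \<open>P one = 0\<close>, the Leibniz rule for \<open>one \<odot> a\<close> has only one surviving term.
\<close>

lemma derivation_commutes_nov_one:
  assumes "derivation scale mult P" and "derivation scale nov P"
  shows "P (one \<odot> a) = one \<odot> P a"
proof -
  have "P one \<odot> a = 0"
    using derivation_one[OF assms(1)] nov_eq_mult[of 0 a] mult_diff_left[of 0 0 "one \<odot> a"]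
    by simp
  then show ?thesis
    using assms(2) by (simp add: derivation_def)
qed

end

theorem theorem2p6:
  fixes scale :: "'k::field \<Rightarrow> 'a::ab_group_add \<Rightarrow> 'a"
    and mult nov :: "'a \<Rightarrow> 'a \<Rightarrow> 'a"
    and one :: 'a
  assumes "jacobi_novikov_poisson_algebra scale mult one nov"
  shows "jacobi_algebra scale mult one (\<lambda>a b. nov a b - nov b a) \<and>
    (\<forall>P. derivation scale mult P \<and> derivation scale nov P \<longrightarrow>
      jacobi_algebra scale mult one (\<lambda>a b. nov (P a) b - nov (P b) a))"
proof -
  interpret jacobi_novikov_poisson_algebra scale mult one nov
    by fact
  have bracket: "(\<lambda>a b. nov (P a) b - nov (P b) a)
      = (\<lambda>a b. mult (P a) (nov one b) - mult (P b) (nov one a))" for P :: "'a \<Rightarrow> 'a"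
    by (intro ext) (metis nov_eq_mult)
  have "jacobi_algebra scale mult one (\<lambda>a b. nov a b - nov b a)"
    unfolding bracket[of "\<lambda>a. a"]
    by (rule wronskian_bracket_jacobi_algebra[OF first_order_operator_id
          first_order_operator_nov_one]) simp
  moreover have "jacobi_algebra scale mult one (\<lambda>a b. nov (P a) b - nov (P b) a)"
    if "derivation scale mult P" "derivation scale nov P" for P
    unfolding bracket
    by (rule wronskian_bracket_jacobi_algebra[OF
          derivation_imp_first_order_operator[OF that(1)] first_order_operator_nov_one])
      (rule derivation_commutes_nov_one[OF that])
  ultimately show ?thesis
    by blast
qed

end
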